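(* Let $d\in\mathbb{N}$, $d\ge 1$, let $1<p<\frac{d+2}{d-2}$ if $d\ge 3$ and $1<p<\infty$ if $d=1,2$, and let $\Omega,\omega,\beta\in\mathbb{R}$. Assume that one of the following holds: (A) $\Omega=0$ and $V(\mathbf{x})=0$ for all $\mathbf{x}\in\mathbb{R}^d$; (B) $\Omega=0$, $V(\mathbf{x})\ge 0$ for all $\mathbf{x}\in\mathbb{R}^d$, and $\lim_{|\mathbf{x}|\to\infty}V(\mathbf{x})=\infty$; (C) $d\ge 2$, $V(\mathbf{x})=\frac12\sum_{j=1}^d\gamma_j^2x_j^2$ with $\gamma_j>0$ for all $j$, and $|\Omega|<\min\{\gamma_1,\gamma_2\}$. If $\beta<0$ and $\omega>-\lambda_0$, then the following holds: (i) the $L^{p+1}$-normalization $\phi\mapsto \phi/\|\phi\|_{L^{p+1}}$ is a bijection from $\mathcal{M}$ to $\mathcal{S}_{p+1}$; (ii) a function $\phi_*\in\mathcal{M}$ minimizes the action functional $S_{\Omega,\omega}$ on $\mathcal{M}$ if and only if its $L^{p+1}$-normalization $u_*:=\phi_*/\|\phi_*\|_{L^{p+1}}\in\mathcal{S}_{p+1}$ minimizes the functional $Q$ on $\mathcal{S}_{p+1}$, i.e. $Q(u_* )=\min_{u\in\mathcal{S}_{p+1}}Q(u)$.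
   Context: Functions are complex-valued on $\mathbb{R}^d$, $\mathbf{x}=(x_1,\dots,x_d)$, and $V:\mathbb{R}^d\to[0,\infty)$ is a given real potential. Let $L_V^2(\mathbb{R}^d)=\{\phi:\int_{\mathbb{R}^d}V|\phi|^2d\mathbf{x}<\infty\}$ and $X=H^1(\mathbb{R}^d)\cap L_V^2(\mathbb{R}^d)$. The angular momentum operator is $L_z=i(x_2\partial_{x_1}-x_1\partial_{x_2})$ if $d\ge2$ and $L_z=0$ if $d=1$. Put $L_\Omega(\phi)=-\Omega\int_{\mathbb{R}^d}\overline{\phi}\,L_z\phi\,d\mathbf{x}$ (equal to $0$ when $\Omega=0$). For $\phi\in X$ define: the action functional $S_{\Omega,\omega}(\phi)=\frac12\|\nabla\phi\|_{L^2}^2+\int_{\mathbb{R}^d}V|\phi|^2d\mathbf{x}+\frac{2\beta}{p+1}\|\phi\|_{L^{p+1}}^{p+1}+L_\Omega(\phi)+\omega\|\phi\|_{L^2}^2$; the Nehari functional $K_{\Omega,\omega}(\phi)=\frac12\|\nabla\phi\|_{L^2}^2+\int_{\mathbb{R}^d}V|\phi|^2d\mathbf{x}+\beta\|\phi\|_{L^{p+1}}^{p+1}+L_\Omega(\phi)+\omega\|\phi\|_{L^2}^2$; the quadratic functional $Q(\phi)=\frac12\|\nabla\phi\|_{L^2}^2+\int_{\mathbb{R}^d}V|\phi|^2d\mathbf{x}+L_\Omega(\phi)+\omega\|\phi\|_{L^2}^2$. The Nehari manifold is $\mathcal{M}=\{\phi\in X\setminus\{0\}: K_{\Omega,\omega}(\phi)=0\}$,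 the $L^{p+1}$ unit sphere in $X$ is $\mathcal{S}_{p+1}=\{u\in X:\|u\|_{L^{p+1}}=1\}$, and $\lambda_0=\inf\left\{\frac12\|\nabla u\|_{L^2}^2+\int_{\mathbb{R}^d}V|u|^2d\mathbf{x}+L_\Omega(u): u\in X,\ \|u\|_{L^2}=1\right\}$. *)

theory Defs
  imports "HOL-Analysis.Analysis"
begin

text \<open>
  The space is \<open>real ^ 'n\<close> with \<open>d = CARD('n)\<close>. Where coordinates have to be numbered, a numbering
  \<open>e\<close> with \<open>bij_betw e {1..CARD('n)} UNIV\<close> is used, so that the j-th coordinate of \<open>x\<close> is
  \<open>x $ e j\<close>. Functions are represented by pointwise representatives; \<open>ae_eq\<close> identifies them.
\<close>

definition ae_eq :: "(('a::euclidean_space \<Rightarrow> 'b) \<times> ('a \<Rightarrow> 'b)) set" where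
  "ae_eq = {(f, g). AE x in lebesgue. f x = g x}"

text \<open>The map that \<open>F\<close> induces on almost-everywhere classes.\<close>

definition class_map ::
  "(('a::euclidean_space \<Rightarrow> 'b) \<Rightarrow> ('a \<Rightarrow> 'b)) \<Rightarrow> ('a \<Rightarrow> 'b) set \<Rightarrow> ('a \<Rightarrow> 'b) set" where
  "class_map F C = (\<Union>f\<in>C. ae_eq `` {F f})"


text \<open>The norm of \<open>L\<^sup>q\<close>. The Bochner integral, hence this value, is \<open>0\<close> when
  \<open>\<bar>f\<bar>\<^sup>q\<close> is not integrable.\<close>

definition Lq_norm :: "real \<Rightarrow> ('a::euclidean_space \<Rightarrow> 'b::real_normed_vector) \<Rightarrow> real" where
  "Lq_norm q f = (LINT x|lebesgue. norm (f x) powr q) powr (1 / q)"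

definition L2_space :: "('a::euclidean_space \<Rightarrow> 'b::real_normed_vector) set" where
  "L2_space = {f \<in> borel_measurable lebesgue. integrable lebesgue (\<lambda>x. (norm (f x))\<^sup>2)}"

definition locally_integrable ::
  "('a::euclidean_space \<Rightarrow> 'b::{banach, second_countable_topology}) \<Rightarrow> bool" where
  "locally_integrable f \<longleftrightarrow> (\<forall>K. compact K \<longrightarrow> set_integrable lebesgue K f)"

primrec C_k :: "nat \<Rightarrow> ('a::euclidean_space \<Rightarrow> 'b::real_normed_vector) \<Rightarrow> bool" where
  "C_k 0 f \<longleftrightarrow> continuous_on UNIV f"
| "C_k (Suc k) f \<longleftrightarrow>
     f differentiable_on UNIV \<and> (\<forall>v. C_k k (\<lambda>x. frechet_derivative f (at x) v))"

definition test_functions :: "('a::euclidean_space \<Rightarrow> complex) set" where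
  "test_functions = {\<psi>. (\<forall>k. C_k k \<psi>) \<and> compact (closure {x. \<psi> x \<noteq> 0})}"

definition has_weak_partial ::
  "'n::finite \<Rightarrow> (real ^ 'n \<Rightarrow> complex) \<Rightarrow> (real ^ 'n \<Rightarrow> complex) \<Rightarrow> bool" where
  "has_weak_partial i \<phi> g \<longleftrightarrow>
     locally_integrable \<phi> \<and> locally_integrable g \<and>
     (\<forall>\<psi>\<in>test_functions.
        (LINT x|lebesgue. \<phi> x * frechet_derivative \<psi> (at x) (axis i 1)) =
        - (LINT x|lebesgue. g x * \<psi> x))"

text \<open>Weak derivatives are unique up to null sets, so the choice below is immaterial.\<close>

definition weak_partial ::
  "'n::finite \<Rightarrow> (real ^ 'n \<Rightarrow> complex) \<Rightarrow> (real ^ 'n \<Rightarrow> complex)" where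
  "weak_partial i \<phi> = (SOME g. has_weak_partial i \<phi> g)"

definition weak_gradient ::
  "(real ^ 'n::finite \<Rightarrow> complex) \<Rightarrow> real ^ 'n \<Rightarrow> complex ^ 'n" where
  "weak_gradient \<phi> x = (\<chi> i. weak_partial i \<phi> x)"

definition H1_space :: "(real ^ 'n::finite \<Rightarrow> complex) set" where
  "H1_space = {\<phi> \<in> L2_space. \<forall>i. \<exists>g\<in>L2_space. has_weak_partial i \<phi> g}"

definition X_space :: "(real ^ 'n::finite \<Rightarrow> real) \<Rightarrow> (real ^ 'n \<Rightarrow> complex) set" where
  "X_space V = {\<phi> \<in> H1_space. integrable lebesgue (\<lambda>x. V x * (cmod (\<phi> x))\<^sup>2)}"


definition L_z ::
  "(nat \<Rightarrow> 'n::finite) \<Rightarrow> (real ^ 'n \<Rightarrow> complex) \<Rightarrow> real ^ 'n \<Rightarrow> complex" where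
  "L_z e \<phi> x =
     (if CARD('n) \<ge> 2
      then \<i> * (of_real (x $ e 2) * weak_partial (e 1) \<phi> x
              - of_real (x $ e 1) * weak_partial (e 2) \<phi> x)
      else 0)"

text \<open>The integral is real because \<open>L_z\<close> is symmetric; \<open>Re\<close> only adjusts the type.\<close>

definition L_rot ::
  "(nat \<Rightarrow> 'n::finite) \<Rightarrow> real \<Rightarrow> (real ^ 'n \<Rightarrow> complex) \<Rightarrow> real" where
  "L_rot e \<Omega> \<phi> = - \<Omega> * Re (LINT x|lebesgue. cnj (\<phi> x) * L_z e \<phi> x)"

definition action_functional ::
  "(nat \<Rightarrow> 'n::finite) \<Rightarrow> (real ^ 'n \<Rightarrow> real) \<Rightarrow> real \<Rightarrow> real \<Rightarrow> real \<Rightarrow> real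
     \<Rightarrow> (real ^ 'n \<Rightarrow> complex) \<Rightarrow> real" where
  "action_functional e V p \<beta> \<Omega> \<omega> \<phi> =
     1 / 2 * (Lq_norm 2 (weak_gradient \<phi>))\<^sup>2
     + (LINT x|lebesgue. V x * (cmod (\<phi> x))\<^sup>2)
     + 2 * \<beta> / (p + 1) * Lq_norm (p + 1) \<phi> powr (p + 1)
     + L_rot e \<Omega> \<phi> + \<omega> * (Lq_norm 2 \<phi>)\<^sup>2"

definition nehari_functional ::
  "(nat \<Rightarrow> 'n::finite) \<Rightarrow> (real ^ 'n \<Rightarrow> real) \<Rightarrow> real \<Rightarrow> real \<Rightarrow> real \<Rightarrow> real
     \<Rightarrow> (real ^ 'n \<Rightarrow> complex) \<Rightarrow> real" where
  "nehari_functional e V p \<beta> \<Omega> \<omega> \<phi> =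
     1 / 2 * (Lq_norm 2 (weak_gradient \<phi>))\<^sup>2
     + (LINT x|lebesgue. V x * (cmod (\<phi> x))\<^sup>2)
     + \<beta> * Lq_norm (p + 1) \<phi> powr (p + 1)
     + L_rot e \<Omega> \<phi> + \<omega> * (Lq_norm 2 \<phi>)\<^sup>2"

definition Q_functional ::
  "(nat \<Rightarrow> 'n::finite) \<Rightarrow> (real ^ 'n \<Rightarrow> real) \<Rightarrow> real \<Rightarrow> real
     \<Rightarrow> (real ^ 'n \<Rightarrow> complex) \<Rightarrow> real" where
  "Q_functional e V \<Omega> \<omega> \<phi> =
     1 / 2 * (Lq_norm 2 (weak_gradient \<phi>))\<^sup>2
     + (LINT x|lebesgue. V x * (cmod (\<phi> x))\<^sup>2)
     + L_rot e \<Omega> \<phi> + \<omega> * (Lq_norm 2 \<phi>)\<^sup>2"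

definition nehari_manifold ::
  "(nat \<Rightarrow> 'n::finite) \<Rightarrow> (real ^ 'n \<Rightarrow> real) \<Rightarrow> real \<Rightarrow> real \<Rightarrow> real \<Rightarrow> real
     \<Rightarrow> (real ^ 'n \<Rightarrow> complex) set" where
  "nehari_manifold e V p \<beta> \<Omega> \<omega> =
     {\<phi> \<in> X_space V. \<not> (AE x in lebesgue. \<phi> x = 0) \<and> nehari_functional e V p \<beta> \<Omega> \<omega> \<phi> = 0}"

definition unit_sphere ::
  "(real ^ 'n::finite \<Rightarrow> real) \<Rightarrow> real \<Rightarrow> (real ^ 'n \<Rightarrow> complex) set" where
  "unit_sphere V q = {u \<in> X_space V. Lq_norm q u = 1}"

definition lambda0 ::
  "(nat \<Rightarrow> 'n::finite) \<Rightarrow> (real ^ 'n \<Rightarrow> real) \<Rightarrow> real \<Rightarrow> real" where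
  "lambda0 e V \<Omega> =
     Inf {1 / 2 * (Lq_norm 2 (weak_gradient u))\<^sup>2
          + (LINT x|lebesgue. V x * (cmod (u x))\<^sup>2) + L_rot e \<Omega> u | u.
          u \<in> X_space V \<and> Lq_norm 2 u = 1}"

definition normalize_Lq ::
  "real \<Rightarrow> ('a::euclidean_space \<Rightarrow> complex) \<Rightarrow> 'a \<Rightarrow> complex" where
  "normalize_Lq q \<phi> x = \<phi> x / of_real (Lq_norm q \<phi>)"

end

theory Submission
  imports Defs
begin

text \<open>
  Write \<open>N(\<phi>) = \<parallel>\<phi>\<parallel>\<close> for the \<open>L\<^sup>p\<^sup>+\<^sup>1\<close> norm. The functional \<open>Q\<close> is quadratic, and \<open>\<omega> > - \<lambda>\<^sub>0\<close> makes it
  positive on nonzero functions. On the Nehari manifold \<open>Q(\<phi>) = - \<beta> N(\<phi>)\<^sup>p\<^sup>+\<^sup>1\<close>, hence for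
  \<open>u = \<phi> / N(\<phi>)\<close> one gets \<open>Q(u) = - \<beta> N(\<phi>)\<^sup>p\<^sup>-\<^sup>1\<close>: the direction \<open>u\<close> determines \<open>N(\<phi>)\<close>,
  which gives the bijection. The action on the manifold is
  \<open>- \<beta> (p - 1) / (p + 1) N(\<phi>)\<^sup>p\<^sup>+\<^sup>1\<close>, so it and \<open>Q(u)\<close> are both increasing functions of \<open>N(\<phi>)\<close>.

  Since \<open>weak_partial\<close> is an arbitrary choice, already the homogeneity of \<open>Q\<close> needs uniqueness of
  weak derivatives, i.e. the fundamental lemma of the calculus of variations.
\<close>

subsection \<open>Smooth bumps and the fundamental lemma\<close>

text \<open>\<open>C_k\<close> refers to \<open>frechet_derivative\<close>, a choice operator. Since
  derivatives are unique, an explicitly computed derivative may stand in for it, which lets the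
  closure lemmas below run by induction on the order.\<close>

lemma C_k_SucI:
  assumes "\<And>x. (f has_derivative f' x) (at x)" and "\<And>v. C_k k (\<lambda>x. f' x v)"
  shows "C_k (Suc k) f"
proof -
  have "f' x = frechet_derivative f (at x)" for x
    by (rule frechet_derivative_at[OF assms(1)])
  then have "f' = (\<lambda>x. frechet_derivative f (at x))"
    by blast
  moreover have "f differentiable_on UNIV"
    using assms(1) by (auto simp: differentiable_on_def differentiable_def)
  ultimately show ?thesis
    using assms(2) by simp
qed

lemma C_k_Suc_has_derivative:
  "C_k (Suc k) f \<Longrightarrow> (f has_derivative frechet_derivative f (at x)) (at x)"
  by (simp add: differentiable_on_def frechet_derivative_works[symmetric])

lemma C_k_SucD: "C_k (Suc k) f \<Longrightarrow> C_k k f"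
proof (induction k arbitrary: f)
  case 0
  then show ?case
    by (simp add: differentiable_imp_continuous_on)
next
  case (Suc k)
  from Suc.prems have 1: "f differentiable_on UNIV"
    and 2: "\<And>v. C_k (Suc k) (\<lambda>x. frechet_derivative f (at x) v)"
    by (auto simp only: C_k.simps)
  show ?case
    unfolding C_k.simps(2)[of k] using 1 Suc.IH[OF 2] by blast
qed

lemma C_k_const: "C_k k (\<lambda>x. c)"
  by (induction k arbitrary: c) (auto intro!: C_k_SucI derivative_eq_intros simp del: C_k.simps(2))

lemma C_k_add: "C_k k f \<Longrightarrow> C_k k g \<Longrightarrow> C_k k (\<lambda>x. f x + g x)"
proof (induction k arbitrary: f g)
  case 0
  then show ?case by (simp add: continuous_on_add)
next
  case (Suc k)
  show ?case
  proof (rule C_k_SucI)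
    show "((\<lambda>x. f x + g x) has_derivative
        (\<lambda>v. frechet_derivative f (at x) v + frechet_derivative g (at x) v)) (at x)" for x
      using Suc.prems by (intro has_derivative_add C_k_Suc_has_derivative)
    show "C_k k (\<lambda>x. frechet_derivative f (at x) v + frechet_derivative g (at x) v)" for v
      using Suc by simp
  qed
qed

lemma C_k_mult:
  fixes f g :: "'a::euclidean_space \<Rightarrow> 'b::real_normed_algebra"
  shows "C_k k f \<Longrightarrow> C_k k g \<Longrightarrow> C_k k (\<lambda>x. f x * g x)"
proof (induction k arbitrary: f g)
  case 0
  then show ?case by (simp add: continuous_on_mult)
next
  case (Suc k)
  show ?case
  proof (rule C_k_SucI)
    show "((\<lambda>x. f x * g x) has_derivative
        (\<lambda>v. f x * frechet_derivative g (at x) v + frechet_derivative f (at x) v * g x)) (at x)" for x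
      using Suc.prems by (intro has_derivative_mult C_k_Suc_has_derivative)
    \<comment> \<open>The product rule keeps one factor undifferentiated; \<open>C_k_SucD\<close>
      lowers it from order \<open>Suc k\<close> to \<open>k\<close>, as the induction hypothesis
      requires.\<close>
    show "C_k k (\<lambda>x. f x * frechet_derivative g (at x) v + frechet_derivative f (at x) v * g x)" for v
      using Suc.IH Suc.prems Suc.prems[THEN C_k_SucD] by (intro C_k_add) simp_all
  qed
qed

lemma C_k_prod:
  fixes f :: "'i \<Rightarrow> 'a::euclidean_space \<Rightarrow> 'b::real_normed_field"
  assumes "finite I" "\<And>i. i \<in> I \<Longrightarrow> C_k k (f i)"
  shows "C_k k (\<lambda>x. \<Prod>i\<in>I. f i x)"
  using assms by (induction I rule: finite_induct) (auto intro: C_k_const C_k_mult)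

section \<open>Flat exponentials and smooth bumps supported in boxes\<close>

definition flat_exp :: "nat \<Rightarrow> real \<Rightarrow> real" where
  "flat_exp m t = (if t > 0 then (1 / t) ^ m * exp (- (1 / t)) else 0)"

lemma flat_exp_0_bounds: "0 \<le> flat_exp 0 t" "flat_exp 0 t \<le> 1"
  by (auto simp: flat_exp_def)

text \<open>With \<open>s = 1 / t\<close> the right-hand limit is that of
  \<open>s ^ m / exp s\<close> at infinity; to the left of 0 the function vanishes.\<close>

lemma flat_exp_tendsto_0: "(flat_exp m \<longlongrightarrow> 0) (at 0)"
proof (rule filterlim_split_at)
  have "((\<lambda>t::real. inverse t ^ m / exp (inverse t)) \<longlongrightarrow> 0) (at_right 0)"
    by (rule filterlim_compose[OF tendsto_power_div_exp_0 filterlim_inverse_at_top_right])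
  then show "(flat_exp m \<longlongrightarrow> 0) (at_right 0)"
    by (rule Lim_transform_eventually)
      (auto simp: eventually_at_right_less flat_exp_def exp_minus field_simps
         intro: eventually_mono[OF eventually_at_right_less])
  show "(flat_exp m \<longlongrightarrow> 0) (at_left 0)"
    by (rule tendsto_eventually)
      (auto simp: flat_exp_def eventually_at_left_field intro!: exI[of _ "-1"])
qed

text \<open>The powers of \<open>1 / t\<close> in \<open>flat_exp\<close> make the family closed
  under differentiation: each derivative is a linear combination of two later members. Smoothness of
  the classical function \<open>exp (- (1 / t))\<close>, the member \<open>m = 0\<close>, then
  follows by induction.\<close>

lemma flat_exp_has_derivative:
  "(flat_exp m has_real_derivative flat_exp (m + 2) t - real m * flat_exp (m + 1) t) (at t)"
proof -
  consider "t > 0" | "t < 0" | "t = 0" by linarith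
  then show ?thesis
  proof cases
    case 1
    have *: "((\<lambda>t. (1 / t) ^ m * exp (- (1 / t))) has_real_derivative
        flat_exp (m + 2) t - real m * flat_exp (m + 1) t) (at t)"
    proof (cases m)
      case 0
      then show ?thesis using 1
        by (auto intro!: derivative_eq_intros simp: flat_exp_def field_simps power2_eq_square)
    next
      case (Suc k)
      show ?thesis using 1 unfolding Suc
        by (auto intro!: derivative_eq_intros simp: flat_exp_def field_simps power2_eq_square)
          (cases k; simp)
    qed
    show ?thesis
      by (rule has_field_derivative_transform_within_open[OF *, of "{0<..}"])
        (use 1 in \<open>auto simp: flat_exp_def\<close>)
  next
    case 2
    have "((\<lambda>_. 0) has_real_derivative 0) (at t)"
      by simp
    then have "(flat_exp m has_real_derivative 0) (at t)"
      by (rule has_field_derivative_transform_within_open[of _ _ _ "{..<0}"])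
        (use 2 in \<open>auto simp: flat_exp_def\<close>)
    then show ?thesis using 2 by (simp add: flat_exp_def)
  next
    case 3
    \<comment> \<open>For nonzero \<open>h\<close> the difference quotient at 0 is exactly
      \<open>flat_exp (Suc m) h\<close>, whose limit is known.\<close>
    have "((\<lambda>h. (flat_exp m (0 + h) - flat_exp m 0) / h) \<longlongrightarrow> 0) (at 0)"
      by (rule Lim_transform_eventually[OF flat_exp_tendsto_0[of "Suc m"]])
        (auto simp: flat_exp_def eventually_at_filter)
    then show ?thesis using 3
      by (simp add: DERIV_def flat_exp_def)
  qed
qed

text \<open>The index \<open>m\<close> is generalized because each differentiation raises it. Along
  an affine function the chain rule adds only the constant factor \<open>v \<bullet> u\<close>, so
  directional derivatives stay in the span of the family.\<close>

lemma C_k_flat_exp: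
  "C_k k (\<lambda>x. complex_of_real (flat_exp m (x \<bullet> u + c)))"
proof (induction k arbitrary: m)
  case 0
  have "continuous_on UNIV (flat_exp m)"
    using flat_exp_has_derivative[of m]
    by (meson DERIV_isCont continuous_at_imp_continuous_on)
  then have "continuous_on UNIV (\<lambda>x. flat_exp m (x \<bullet> u + c))"
    by (rule continuous_on_compose2) (intro continuous_intros subset_UNIV)+
  then show ?case
    by (simp add: continuous_on_of_real)
next
  case (Suc k)
  show ?case
  proof (rule C_k_SucI)
    let ?d = "\<lambda>t. flat_exp (m + 2) t - real m * flat_exp (m + 1) t"
    show "((\<lambda>x. complex_of_real (flat_exp m (x \<bullet> u + c))) has_derivative
        (\<lambda>v. of_real (?d (x \<bullet> u + c) * (v \<bullet> u)))) (at x)" for x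
      by (rule has_derivative_of_real, rule has_derivative_eq_rhs,
          rule has_derivative_compose[OF _ flat_exp_has_derivative[THEN has_field_derivative_imp_has_derivative]])
        (auto intro!: derivative_eq_intros)
    have eq: "(\<lambda>x. complex_of_real (?d (x \<bullet> u + c) * (v \<bullet> u))) =
       (\<lambda>x. of_real (flat_exp (m + 2) (x \<bullet> u + c)) * of_real (v \<bullet> u)
           + of_real (flat_exp (m + 1) (x \<bullet> u + c)) * of_real (- real m * (v \<bullet> u)))" for v
      by (auto simp: algebra_simps)
    show "C_k k (\<lambda>x. complex_of_real (?d (x \<bullet> u + c) * (v \<bullet> u)))" for v
      unfolding eq by (intro C_k_add C_k_mult C_k_const Suc)
  qed
qed

text \<open>Each coordinate contributes one flat factor per face, nonzero exactly on the inner side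
  of that face. The scale \<open>Suc n\<close> is always positive, and its growth drives every
  factor to 1 inside the box.\<close>

definition box_bump :: "'a::euclidean_space \<Rightarrow> 'a \<Rightarrow> nat \<Rightarrow> 'a \<Rightarrow> complex" where
  "box_bump a b n x = (\<Prod>i\<in>Basis. of_real (flat_exp 0 (real (Suc n) * (x \<bullet> i - a \<bullet> i)))
                        * of_real (flat_exp 0 (real (Suc n) * (b \<bullet> i - x \<bullet> i))))"

lemma box_bump_outside: "x \<notin> box a b \<Longrightarrow> box_bump a b n x = 0"
  unfolding box_bump_def mem_box
  by (subst prod_zero_iff) (auto simp: flat_exp_def zero_less_mult_iff simp del: of_nat_Suc)

lemma norm_box_bump_le: "norm (box_bump a b n x) \<le> 1"
  unfolding box_bump_def prod_norm[symmetric] norm_mult norm_of_real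
  by (intro prod_le_1) (simp add: flat_exp_0_bounds mult_le_one)

lemma box_bump_in_test_functions: "box_bump a b n \<in> test_functions"
proof -
  \<comment> \<open>Distributing the scale gives affine arguments, the form that
    \<open>C_k_flat_exp\<close> expects.\<close>
  have eq: "box_bump a b n = (\<lambda>x. \<Prod>i\<in>Basis.
      of_real (flat_exp 0 (x \<bullet> (real (Suc n) *\<^sub>R i) + - real (Suc n) * (a \<bullet> i)))
      * of_real (flat_exp 0 (x \<bullet> (- real (Suc n) *\<^sub>R i) + real (Suc n) * (b \<bullet> i))))"
    unfolding box_bump_def by (simp only: inner_scaleR_right) (simp add: algebra_simps)
  have "C_k k (box_bump a b n)" for k
    unfolding eq by (intro C_k_prod C_k_mult C_k_flat_exp finite_Basis)
  moreover have "{x. box_bump a b n x \<noteq> 0} \<subseteq> box a b"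
    using box_bump_outside by blast
  then have "compact (closure {x. box_bump a b n x \<noteq> 0})"
    using bounded_subset[OF bounded_box] by (simp add: compact_closure)
  ultimately show ?thesis
    by (simp add: test_functions_def)
qed

text \<open>For positive \<open>t\<close> the exponent \<open>- 1 / (Suc n * t)\<close> tends to 0.
  For all other \<open>t\<close>, including 0, every term vanishes, so the limit of the bumps is the
  indicator of the open box.\<close>

lemma flat_exp_0_scaled_tendsto:
  "(\<lambda>n. flat_exp 0 (real (Suc n) * t)) \<longlonglongrightarrow> (if t > 0 then 1 else 0)"
proof (cases "t > 0")
  case True
  have "(\<lambda>n. exp (- (inverse (real (Suc n)) * (1 / t)))) \<longlonglongrightarrow> exp (- (0 * (1 / t)))"
    by (intro tendsto_intros LIMSEQ_inverse_real_of_nat)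
  moreover have "flat_exp 0 (real (Suc n) * t) = exp (- (inverse (real (Suc n)) * (1 / t)))" for n
    using True by (simp add: flat_exp_def zero_less_mult_iff inverse_eq_divide)
  ultimately show ?thesis using True by simp
next
  case False
  then show ?thesis by (simp add: flat_exp_def zero_less_mult_iff)
qed

lemma box_bump_tendsto: "(\<lambda>n. box_bump a b n x) \<longlonglongrightarrow> indicator (box a b) x"
proof -
  let ?s = "\<lambda>t. complex_of_real (if t > (0::real) then 1 else 0)"
  have "(\<lambda>n. box_bump a b n x) \<longlonglongrightarrow> (\<Prod>i\<in>Basis. ?s (x \<bullet> i - a \<bullet> i) * ?s (b \<bullet> i - x \<bullet> i))"
    unfolding box_bump_def by (intro tendsto_prod tendsto_mult tendsto_of_real flat_exp_0_scaled_tendsto)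
  also have "(\<Prod>i\<in>Basis. ?s (x \<bullet> i - a \<bullet> i) * ?s (b \<bullet> i - x \<bullet> i)) = indicator (box a b) x"
  proof (cases "x \<in> box a b")
    case True
    then show ?thesis by (simp add: mem_box)
  next
    case False
    then have "\<exists>i\<in>Basis. ?s (x \<bullet> i - a \<bullet> i) * ?s (b \<bullet> i - x \<bullet> i) = 0"
      by (auto simp: mem_box)
    then have "(\<Prod>i\<in>Basis. ?s (x \<bullet> i - a \<bullet> i) * ?s (b \<bullet> i - x \<bullet> i)) = 0"
      by (intro prod_zero finite_Basis)
    with False show ?thesis by simp
  qed
  finally show ?thesis .
qed

section \<open>Pairing locally integrable functions with test functions\<close>

lemma test_function_continuous: "\<psi> \<in> test_functions \<Longrightarrow> continuous_on UNIV \<psi>"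
  unfolding test_functions_def C_k.simps(1)[symmetric] by blast

text \<open>A test function is bounded and vanishes off the compact set \<open>?K\<close>, on which
  \<open>g\<close> is integrable; a multiple of the cut-off \<open>g\<close> dominates the
  product.\<close>

lemma integrable_mult_test_function:
  fixes g :: "'a::euclidean_space \<Rightarrow> complex"
  assumes g: "locally_integrable g" and \<psi>: "\<psi> \<in> test_functions"
  shows "integrable lebesgue (\<lambda>x. g x * \<psi> x)"
proof -
  let ?K = "closure {x. \<psi> x \<noteq> 0}"
  have K: "compact ?K" and cont: "continuous_on UNIV \<psi>"
    using \<psi> test_function_continuous by (auto simp: test_functions_def)
  have "compact (\<psi> ` ?K)"
    by (rule compact_continuous_image[OF continuous_on_subset[OF cont] K]) auto
  then obtain B where B: "\<And>x. x \<in> ?K \<Longrightarrow> cmod (\<psi> x) \<le> B"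
    by (meson bounded_iff compact_imp_bounded imageI)
  have int: "integrable lebesgue (\<lambda>x. indicator ?K x *\<^sub>R g x)"
    using g K by (simp add: locally_integrable_def set_integrable_def)
  have eq: "g x * \<psi> x = (indicator ?K x *\<^sub>R g x) * \<psi> x" for x
    using closure_subset[of "{x. \<psi> x \<noteq> 0}"] by (auto simp: indicator_def)
  have [measurable]: "\<psi> \<in> borel_measurable lebesgue"
    using cont by (simp add: borel_measurable_continuous_onI measurable_completion)
  note [measurable] = borel_measurable_integrable[OF int]
  show ?thesis
  proof (rule Bochner_Integration.integrable_bound[OF integrable_mult_right[OF int, of "of_real B"]])
    show "(\<lambda>x. g x * \<psi> x) \<in> borel_measurable lebesgue"
      unfolding eq by measurable
    have "cmod (g x * \<psi> x) \<le> cmod (of_real B * (indicator ?K x *\<^sub>R g x))" for x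
    proof (cases "x \<in> ?K")
      case True
      with B[OF this] have "cmod (\<psi> x) \<le> \<bar>B\<bar>" by linarith
      with True show ?thesis
        by (simp add: norm_mult mult.commute mult_right_mono)
    qed (simp add: eq)
    then show "AE x in lebesgue. cmod (g x * \<psi> x) \<le> cmod (of_real B * (indicator ?K x *\<^sub>R g x))"
      by simp
  qed
qed

text \<open>Boxes are stable under intersection and generate the Borel sets, so a Dynkin-system
  induction carries the vanishing integrals to all Borel sets. Null sets extend this to Lebesgue
  sets, and \<open>density_zero\<close> concludes.\<close>

lemma AE_eq_0_of_box_integrals:
  fixes f :: "'a::euclidean_space \<Rightarrow> 'b::{banach, second_countable_topology}"
  assumes f: "integrable lebesgue f"
    and total: "(LINT x|lebesgue. f x) = 0"
    and boxes: "\<And>a b. (LINT x:box a b|lebesgue. f x) = 0"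
  shows "AE x in lebesgue. f x = 0"
proof -
  \<comment> \<open>\<open>density_zero\<close> lives in a sigma-finite measure space; the countable
    cover of \<open>lborel\<close> keeps its finite measures in the completion.\<close>
  obtain C :: "'a set set" where C: "countable C \<and> C \<subseteq> sets lborel \<and> \<Union>C = space lborel
      \<and> (\<forall>a\<in>C. emeasure lborel a \<noteq> \<infinity>)"
    using lborel.sigma_finite_countable by (rule exE)
  interpret sigma_finite_measure "lebesgue :: 'a measure"
  proof (unfold_locales, intro exI[of _ C] conjI ballI)
    show "C \<subseteq> sets lebesgue"
      using C sets_completionI_sets by blast
    fix a assume "a \<in> C"
    with C have "a \<in> sets lborel" "emeasure lborel a \<noteq> \<infinity>" by blast+
    then show "emeasure lebesgue a \<noteq> \<infinity>"
      by (simp only: emeasure_completion main_part sets_completionI_sets not_False_eq_True)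
  qed (use C in simp_all)
  have si: "set_integrable lebesgue A f" if "A \<in> sets lebesgue" for A
    using that f unfolding set_integrable_def by (rule integrable_mult_indicator)
  have borel: "(LINT x:A|lebesgue. f x) = 0" if A: "A \<in> sets borel" for A
  proof -
    have "Int_stable (range (\<lambda>(a, b). box a b :: 'a set))"
      by (auto simp: Int_stable_def box_Int_box)
    moreover have "(range (\<lambda>(a, b). box a b :: 'a set)) \<subseteq> Pow UNIV"
      by auto
    moreover have "A \<in> sigma_sets UNIV (range (\<lambda>(a, b). box a b))"
      using A unfolding borel_eq_box by simp
    ultimately show ?thesis
    proof (induction rule: sigma_sets_induct_disjoint)
      case (basic A)
      then show ?case using boxes by auto
    next
      case empty
      then show ?case by (simp add: set_lebesgue_integral_def)
    next
      case (compl A)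
      then have A: "A \<in> sets lebesgue" by (simp add: borel_eq_box)
      \<comment> \<open>The two integrals add up to the integral over the whole space, which is 0 by
        \<open>total\<close>.\<close>
      have "(LINT x:A \<union> (UNIV - A)|lebesgue. f x)
          = (LINT x:A|lebesgue. f x) + (LINT x:(UNIV - A)|lebesgue. f x)"
        using A by (intro set_integral_Un si) auto
      then show ?case
        using compl total by (simp add: set_lebesgue_integral_def)
    next
      case (union A)
      then have [measurable]: "A i \<in> sets lebesgue" for i
        by (simp add: borel_eq_box subset_eq)
      have "(LINT x:(\<Union>i. A i)|lebesgue. f x) = (\<Sum>i. LINT x:A i|lebesgue. f x)"
        using union(1) by (intro lebesgue_integral_countable_add si) (auto simp: disjoint_family_on_def)
      then show ?case using union by simp
    qed
  qed
  have "(LINT x:A|lebesgue. f x) = 0" if "A \<in> sets lebesgue" for A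
  proof -
  \<comment> \<open>A Lebesgue set differs from a Borel set \<open>S\<close> only within a null set,
    which the integral does not see.\<close>
  from that obtain S N N' where A: "A = S \<union> N" "N \<subseteq> N'" "N' \<in> null_sets lborel" "S \<in> sets lborel"
    by (rule sets_completionE) blast
  then have N': "N' \<in> null_sets lebesgue"
    by (simp add: null_sets_completionI)
  have "(LINT x:A|lebesgue. f x) = (LINT x:S|lebesgue. f x)"
    unfolding set_lebesgue_integral_def
  proof (rule integral_cong_AE)
    show "(\<lambda>x. indicat_real A x *\<^sub>R f x) \<in> borel_measurable lebesgue"
      "(\<lambda>x. indicat_real S x *\<^sub>R f x) \<in> borel_measurable lebesgue"
      using si that A by (simp_all add: set_integrable_def borel_measurable_integrable)
    show "AE x in lebesgue. indicat_real A x *\<^sub>R f x = indicat_real S x *\<^sub>R f x"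
      by (rule AE_I'[OF N']) (use A in \<open>auto simp: indicator_def\<close>)
  qed
  then show ?thesis
    using borel A by simp
  qed
  then show ?thesis by (rule density_zero[OF f])
qed

text \<open>The bumps converge boundedly to the indicator of a box, so \<open>g\<close> integrates to zero over every box.\<close>

lemma fundamental_lemma_calculus_of_variations:
  fixes g :: "'a::euclidean_space \<Rightarrow> complex"
  assumes g: "locally_integrable g"
    and zero: "\<And>\<psi>. \<psi> \<in> test_functions \<Longrightarrow> (LINT x|lebesgue. g x * \<psi> x) = 0"
  shows "AE x in lebesgue. g x = 0"
proof -
  have int: "integrable lebesgue (\<lambda>x. indicator (box a b) x *\<^sub>R g x)" for a b
  proof -
    have "set_integrable lebesgue (cbox a b) g"
      using g by (simp add: locally_integrable_def)
    then have "set_integrable lebesgue (box a b) g"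
      by (rule set_integrable_subset) (auto simp: box_subset_cbox)
    then show ?thesis by (simp add: set_integrable_def)
  qed
  have boxes: "(LINT x|lebesgue. indicator (box a b) x *\<^sub>R g x) = 0" for a b
  proof -
    have "(\<lambda>n. LINT x|lebesgue. g x * box_bump a b n x) \<longlonglongrightarrow>
        (LINT x|lebesgue. indicator (box a b) x *\<^sub>R g x)"
    proof (rule integral_dominated_convergence[where w = "\<lambda>x. cmod (indicator (box a b) x *\<^sub>R g x)"])
      show "integrable lebesgue (\<lambda>x. cmod (indicator (box a b) x *\<^sub>R g x))"
        using int by (rule integrable_norm)
      show "(\<lambda>x. g x * box_bump a b n x) \<in> borel_measurable lebesgue" for n
        using integrable_mult_test_function[OF g box_bump_in_test_functions]
        by (rule borel_measurable_integrable)
      have "(\<lambda>n. g x * box_bump a b n x) \<longlonglongrightarrow> g x * indicator (box a b) x" for x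
        by (intro tendsto_intros box_bump_tendsto)
      moreover have "g x * indicator (box a b) x = indicator (box a b) x *\<^sub>R g x" for x
        by (simp add: indicator_def)
      ultimately show "AE x in lebesgue. (\<lambda>n. g x * box_bump a b n x) \<longlonglongrightarrow> indicator (box a b) x *\<^sub>R g x"
        by simp
      have "cmod (g x * box_bump a b n x) \<le> cmod (indicator (box a b) x *\<^sub>R g x)" for n x
        using norm_box_bump_le[of a b n x] box_bump_outside[of x a b n]
        by (cases "x \<in> box a b") (auto simp: norm_mult mult_left_le)
      then show "AE x in lebesgue. cmod (g x * box_bump a b n x) \<le> cmod (indicator (box a b) x *\<^sub>R g x)" for n
        by simp
    qed (use borel_measurable_integrable[OF int] in auto)
    then show ?thesis
      by (simp add: zero box_bump_in_test_functions LIMSEQ_const_iff)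
  qed
  \<comment> \<open>Since \<open>g\<close> is only locally integrable, it is cut off by boxes that
    exhaust the space. The intersection of two boxes is a box, so \<open>boxes\<close> also gives
    the box integrals of the cut-off function.\<close>
  define B where "B n = box (- real n *\<^sub>R One) (real n *\<^sub>R One :: 'a)" for n
  have "AE x in lebesgue. indicator (B n) x *\<^sub>R g x = 0" for n
  proof (rule AE_eq_0_of_box_integrals)
    show "(LINT x:box a b|lebesgue. indicator (B n) x *\<^sub>R g x) = 0" for a b
      unfolding set_lebesgue_integral_def B_def scaleR_scaleR indicator_inter_arith[symmetric]
        box_Int_box by (rule boxes)
  qed (auto simp: B_def int boxes)
  then have "AE x in lebesgue. \<forall>n. indicator (B n) x *\<^sub>R g x = 0"
    unfolding AE_all_countable by blast
  then show ?thesis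
  proof (rule eventually_mono)
    fix x
    assume *: "\<forall>n. indicator (B n) x *\<^sub>R g x = 0"
    have "(\<Union>n. B n) = UNIV"
      unfolding B_def using UN_box_eq_UNIV[where 'a = 'a] by simp
    then obtain n where "x \<in> B n" by blast
    with *[rule_format, of n] show "g x = 0" by simp
  qed
qed

subsection \<open>Weak derivatives and homogeneity\<close>

text \<open>The form with both a factor and an almost-everywhere equality serves two purposes:
  scalar multiples and, with \<open>c = 1\<close>, a change of representative.\<close>

lemma L2_space_cmult_AE:
  fixes f g :: "'a::euclidean_space \<Rightarrow> complex"
  assumes g: "g \<in> L2_space" and f: "f \<in> borel_measurable lebesgue"
    and eq: "AE x in lebesgue. f x = c * g x"
  shows "f \<in> L2_space"
proof -
  from g have [measurable]: "g \<in> borel_measurable lebesgue"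
    and int: "integrable lebesgue (\<lambda>x. (cmod (g x))\<^sup>2)"
    by (auto simp: L2_space_def)
  note f [measurable]
  have "integrable lebesgue (\<lambda>x. (cmod (f x))\<^sup>2)"
  proof (rule integrable_cong_AE_imp[OF integrable_mult_right[OF int, of "(cmod c)\<^sup>2"]])
    show "AE x in lebesgue. (cmod c)\<^sup>2 * (cmod (g x))\<^sup>2 = (cmod (f x))\<^sup>2"
      using eq by eventually_elim (simp add: norm_mult power_mult_distrib)
  qed measurable
  with f show ?thesis by (simp add: L2_space_def)
qed

lemma locally_integrable_cmult_AE:
  fixes f g :: "'a::euclidean_space \<Rightarrow> complex"
  assumes g: "locally_integrable g" and f: "f \<in> borel_measurable lebesgue"
    and eq: "AE x in lebesgue. f x = c * g x"
  shows "locally_integrable f"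
  unfolding locally_integrable_def set_integrable_def
proof (intro allI impI)
  fix K :: "'a set"
  assume K: "compact K"
  then have [measurable]: "K \<in> sets lebesgue"
    by (simp add: lmeasurable_compact fmeasurableD)
  note f [measurable]
  from g K have int: "integrable lebesgue (\<lambda>x. indicator K x *\<^sub>R g x)"
    by (simp add: locally_integrable_def set_integrable_def)
  show "integrable lebesgue (\<lambda>x. indicat_real K x *\<^sub>R f x)"
  proof (rule integrable_cong_AE_imp[OF integrable_mult_right[OF int, of c]])
    show "AE x in lebesgue. c * (indicat_real K x *\<^sub>R g x) = indicat_real K x *\<^sub>R f x"
      using eq by eventually_elim simp
  qed measurable
qed

text \<open>Off its closed support, on an open set, \<open>\<psi>\<close> is identically 0 and so is
  its derivative; hence differentiation does not enlarge the support.\<close>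

lemma test_function_partial:
  fixes \<psi> :: "'a::euclidean_space \<Rightarrow> complex"
  assumes "\<psi> \<in> test_functions"
  shows "(\<lambda>x. frechet_derivative \<psi> (at x) v) \<in> test_functions"
proof -
  let ?d = "\<lambda>x. frechet_derivative \<psi> (at x) v"
  have smooth: "C_k k \<psi>" for k
    using assms by (auto simp: test_functions_def)
  have cpt: "compact (closure {x. \<psi> x \<noteq> 0})"
    using assms by (auto simp: test_functions_def)
  have "C_k k ?d" for k
    using smooth[of "Suc k"] by simp
  moreover have "{x. ?d x \<noteq> 0} \<subseteq> closure {x. \<psi> x \<noteq> 0}"
  proof (rule ccontr)
    assume "\<not> {x. ?d x \<noteq> 0} \<subseteq> closure {x. \<psi> x \<noteq> 0}"
    then obtain x where x: "?d x \<noteq> 0" "x \<in> - closure {x. \<psi> x \<noteq> 0}" by blast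
    have "(\<psi> has_derivative (\<lambda>_. 0)) (at x)"
      by (rule has_derivative_transform_within_open[of "\<lambda>_. 0" _ _ _ "- closure {x. \<psi> x \<noteq> 0}"])
        (use x closure_subset[of "{x. \<psi> x \<noteq> 0}"] in auto)
    then have "frechet_derivative \<psi> (at x) = (\<lambda>_. 0)"
      by (rule frechet_derivative_at[symmetric])
    with x show False by simp
  qed
  then have "closure {x. ?d x \<noteq> 0} \<subseteq> closure {x. \<psi> x \<noteq> 0}"
    by (rule closure_minimal) simp
  then have "compact (closure {x. ?d x \<noteq> 0})"
    using cpt by (metis closed_Int_compact closed_closure inf.absorb_iff1)
  ultimately show ?thesis by (simp add: test_functions_def)
qed

text \<open>The cut-offs to balls of radius \<open>n\<close> are integrable, hence measurable, and
  at each point they are eventually equal to \<open>f\<close>.\<close>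

lemma locally_integrable_measurable:
  assumes "locally_integrable (f :: 'a::euclidean_space \<Rightarrow> complex)"
  shows "f \<in> borel_measurable lebesgue"
proof (rule borel_measurable_LIMSEQ_metric)
  let ?f = "\<lambda>n x. indicator (cball 0 (real n)) x *\<^sub>R f x"
  show "?f n \<in> borel_measurable lebesgue" for n
    using assms by (simp add: locally_integrable_def set_integrable_def borel_measurable_integrable)
  show "(\<lambda>n. ?f n x) \<longlonglongrightarrow> f x" for x
  proof (rule tendsto_eventually)
    obtain N where "norm x \<le> real N" using real_arch_simple by blast
    then show "\<forall>\<^sub>F n in sequentially. ?f n x = f x"
      unfolding eventually_sequentially
      by (intro exI[of _ N]) (auto simp: indicator_def)
  qed
qed

text \<open>The difference of two weak partials integrates to 0 against every test function, so the
  fundamental lemma applies. This makes the choice in \<open>weak_partial\<close> harmless.\<close>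

lemma has_weak_partial_unique:
  assumes g: "has_weak_partial i \<phi> g" and h: "has_weak_partial i \<phi> h"
  shows "AE x in lebesgue. g x = h x"
proof -
  have lg: "locally_integrable g" and lh: "locally_integrable h"
    using g h by (auto simp: has_weak_partial_def)
  have "AE x in lebesgue. g x - h x = 0"
  proof (rule fundamental_lemma_calculus_of_variations)
    show "locally_integrable (\<lambda>x. g x - h x)"
      using lg lh unfolding locally_integrable_def
      by (simp add: set_integrable_def scaleR_diff_right)
    fix \<psi> :: "real ^ 'a \<Rightarrow> complex"
    assume \<psi>: "\<psi> \<in> test_functions"
    have "(LINT x|lebesgue. (g x - h x) * \<psi> x) = (LINT x|lebesgue. g x * \<psi> x) - (LINT x|lebesgue. h x * \<psi> x)"
      unfolding left_diff_distrib
      by (intro Bochner_Integration.integral_diff integrable_mult_test_function lg lh \<psi>)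
    also have "\<dots> = 0"
      using g h \<psi> by (simp add: has_weak_partial_def)
    finally show "(LINT x|lebesgue. (g x - h x) * \<psi> x) = 0" .
  qed
  then show ?thesis by simp
qed

lemma has_weak_partial_weak_partial:
  "has_weak_partial i \<phi> g \<Longrightarrow> has_weak_partial i \<phi> (weak_partial i \<phi>)"
  unfolding weak_partial_def by (rule someI[of "has_weak_partial i \<phi>"])

lemma has_weak_partial_cmult_AE:
  assumes \<psi>: "has_weak_partial i \<psi> g" and \<phi>: "\<phi> \<in> borel_measurable lebesgue"
    and eq: "AE x in lebesgue. \<phi> x = c * \<psi> x"
  shows "has_weak_partial i \<phi> (\<lambda>x. c * g x)"
  unfolding has_weak_partial_def
proof (intro conjI ballI)
  have l\<psi>: "locally_integrable \<psi>" and lg: "locally_integrable g"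
    using \<psi> by (auto simp: has_weak_partial_def)
  then have [measurable]: "\<psi> \<in> borel_measurable lebesgue" "g \<in> borel_measurable lebesgue"
    using locally_integrable_measurable by auto
  show l\<phi>: "locally_integrable \<phi>"
    using l\<psi> \<phi> eq by (rule locally_integrable_cmult_AE)
  show lcg: "locally_integrable (\<lambda>x. c * g x)"
    by (rule locally_integrable_cmult_AE[OF lg _ AE_I2]) auto
  fix \<eta> :: "real ^ 'a \<Rightarrow> complex"
  assume \<eta>: "\<eta> \<in> test_functions"
  let ?d = "\<lambda>x. frechet_derivative \<eta> (at x) (axis i 1)"
  \<comment> \<open>The derivative of a test function is again one, so its products with
    \<open>\<phi>\<close> and \<open>\<psi>\<close> are integrable and in particular
    measurable.\<close>
  have d: "?d \<in> test_functions" using \<eta> by (rule test_function_partial)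
  have "(LINT x|lebesgue. \<phi> x * ?d x) = (LINT x|lebesgue. c * (\<psi> x * ?d x))"
  proof (rule integral_cong_AE)
    show "(\<lambda>x. \<phi> x * ?d x) \<in> borel_measurable lebesgue"
      by (rule borel_measurable_integrable[OF integrable_mult_test_function[OF l\<phi> d]])
    show "(\<lambda>x. c * (\<psi> x * ?d x)) \<in> borel_measurable lebesgue"
      by (intro borel_measurable_integrable integrable_mult_right integrable_mult_test_function[OF l\<psi> d])
    show "AE x in lebesgue. \<phi> x * ?d x = c * (\<psi> x * ?d x)"
      using eq by eventually_elim simp
  qed
  also have "\<dots> = c * (LINT x|lebesgue. \<psi> x * ?d x)"
    by (rule integral_mult_right_zero)
  also have "\<dots> = c * - (LINT x|lebesgue. g x * \<eta> x)"
    using \<psi> \<eta> by (simp add: has_weak_partial_def)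
  also have "\<dots> = - (LINT x|lebesgue. c * g x * \<eta> x)"
    by (simp add: mult.assoc)
  finally show "(LINT x|lebesgue. \<phi> x * ?d x) = - (LINT x|lebesgue. c * g x * \<eta> x)" .
qed

lemma X_space_measurable: "\<phi> \<in> X_space V \<Longrightarrow> \<phi> \<in> borel_measurable lebesgue"
  by (simp add: X_space_def H1_space_def L2_space_def)

text \<open>\<open>H1_space\<close> provides some square-integrable weak partial; by uniqueness the
  chosen one agrees with it almost everywhere and inherits its integrability.\<close>

lemma X_space_weak_partial:
  assumes "\<phi> \<in> X_space V"
  shows "has_weak_partial i \<phi> (weak_partial i \<phi>)" and "weak_partial i \<phi> \<in> L2_space"
proof -
  from assms obtain g where g: "g \<in> L2_space" "has_weak_partial i \<phi> g"
    by (auto simp: X_space_def H1_space_def)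
  from g(2) show w: "has_weak_partial i \<phi> (weak_partial i \<phi>)"
    by (rule has_weak_partial_weak_partial)
  have "weak_partial i \<phi> \<in> borel_measurable lebesgue"
    using w locally_integrable_measurable by (auto simp: has_weak_partial_def)
  moreover have "AE x in lebesgue. weak_partial i \<phi> x = 1 * g x"
    using has_weak_partial_unique[OF w g(2)] by simp
  ultimately show "weak_partial i \<phi> \<in> L2_space"
    by (rule L2_space_cmult_AE[OF g(1)])
qed

text \<open>Both sides are weak partials of \<open>\<phi>\<close>, so uniqueness identifies
  them.\<close>

lemma weak_partial_cmult_AE:
  assumes "\<phi> \<in> X_space V" "\<psi> \<in> X_space V" "AE x in lebesgue. \<phi> x = c * \<psi> x"
  shows "AE x in lebesgue. weak_partial i \<phi> x = c * weak_partial i \<psi> x"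
  using X_space_weak_partial(1)[OF assms(1)]
    has_weak_partial_cmult_AE[OF X_space_weak_partial(1)[OF assms(2)] X_space_measurable[OF assms(1)] assms(3)]
  by (rule has_weak_partial_unique)

lemma X_space_cmult:
  assumes \<psi>: "\<psi> \<in> X_space V"
  shows "(\<lambda>x. c * \<psi> x) \<in> X_space V"
proof -
  let ?\<phi> = "\<lambda>x. c * \<psi> x"
  note X_space_measurable[OF \<psi>, measurable]
  have "?\<phi> \<in> L2_space"
    by (rule L2_space_cmult_AE[of \<psi> _ c]) (use \<psi> in \<open>auto simp: X_space_def H1_space_def L2_space_def\<close>)
  moreover have "\<exists>g\<in>L2_space. has_weak_partial i ?\<phi> g" for i
  proof (rule bexI)
    show "has_weak_partial i ?\<phi> (\<lambda>x. c * weak_partial i \<psi> x)"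
      by (rule has_weak_partial_cmult_AE[OF X_space_weak_partial(1)[OF \<psi>]]) auto
    show "(\<lambda>x. c * weak_partial i \<psi> x) \<in> L2_space"
      by (rule L2_space_cmult_AE[of "weak_partial i \<psi>" _ c])
        (use X_space_weak_partial(2)[OF \<psi>, of i] in \<open>auto simp: L2_space_def\<close>)
  qed
  moreover have "integrable lebesgue (\<lambda>x. V x * (cmod (?\<phi> x))\<^sup>2)"
  proof -
    have "integrable lebesgue (\<lambda>x. (cmod c)\<^sup>2 * (V x * (cmod (\<psi> x))\<^sup>2))"
      using \<psi> by (intro integrable_mult_right) (simp add: X_space_def)
    then show ?thesis by (simp add: norm_mult power_mult_distrib mult_ac)
  qed
  ultimately show ?thesis by (simp add: X_space_def H1_space_def)
qed

section \<open>Scaling of the norms and of the quadratic functional\<close>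

lemma Lq_norm_nonneg: "0 \<le> Lq_norm q f"
  by (simp add: Lq_norm_def)

lemma Lq_norm_cmult_AE:
  fixes f g :: "'a::euclidean_space \<Rightarrow> 'b::{real_normed_vector, second_countable_topology}"
  assumes [measurable]: "f \<in> borel_measurable lebesgue" "g \<in> borel_measurable lebesgue"
    and eq: "AE x in lebesgue. norm (f x) = r * norm (g x)" and r: "0 \<le> r" and q: "q \<noteq> 0"
  shows "Lq_norm q f = r * Lq_norm q g"
proof -
  have "(LINT x|lebesgue. norm (f x) powr q) = (LINT x|lebesgue. r powr q * norm (g x) powr q)"
  proof (rule integral_cong_AE)
    show "AE x in lebesgue. norm (f x) powr q = r powr q * norm (g x) powr q"
      using eq by eventually_elim (simp add: powr_mult r)
  qed measurable
  \<comment> \<open>\<open>integral_mult_right_zero\<close> also covers a non-integrable integrand,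
    for which both sides are 0.\<close>
  also have "\<dots> = r powr q * (LINT x|lebesgue. norm (g x) powr q)"
    by (rule integral_mult_right_zero)
  finally show ?thesis
    using r q by (simp add: Lq_norm_def powr_mult powr_powr)
qed

lemma Lq_norm_2_squared:
  "(Lq_norm 2 f)\<^sup>2 = (LINT x|lebesgue. (norm (f x))\<^sup>2)"
  by (simp add: Lq_norm_def powr_half_sqrt)

lemma L2_space_norm_eq_0:
  assumes "f \<in> L2_space" "Lq_norm 2 f = 0"
  shows "AE x in lebesgue. f x = 0"
proof -
  have "(LINT x|lebesgue. (norm (f x))\<^sup>2) = 0"
    using assms(2) Lq_norm_2_squared[of f] by simp
  then have "AE x in lebesgue. (norm (f x))\<^sup>2 = 0"
    using assms(1) by (subst (asm) integral_nonneg_eq_0_iff_AE) (auto simp: L2_space_def)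
  then show ?thesis by simp
qed

lemma norm_weak_gradient_squared:
  "(norm (weak_gradient \<phi> x))\<^sup>2 = (\<Sum>i\<in>UNIV. (cmod (weak_partial i \<phi> x))\<^sup>2)"
  by (simp add: norm_vec_def L2_set_def weak_gradient_def sum_nonneg)

lemma integrable_norm_weak_gradient_squared:
  assumes "\<phi> \<in> X_space V"
  shows "integrable lebesgue (\<lambda>x. (norm (weak_gradient \<phi> x))\<^sup>2)"
  unfolding norm_weak_gradient_squared
  using X_space_weak_partial(2)[OF assms] by (intro Bochner_Integration.integrable_sum) (simp add: L2_space_def)

lemma coordinate_measurable [measurable]: "(\<lambda>x::real ^ 'n. x $ i) \<in> borel_measurable lebesgue"
  by (intro measurable_completion) (simp add: borel_measurable_continuous_onI continuous_on_component)

lemma X_space_weak_partial_measurable: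
  "\<phi> \<in> X_space V \<Longrightarrow> weak_partial i \<phi> \<in> borel_measurable lebesgue"
  using X_space_weak_partial(2)[of \<phi> V i] by (simp add: L2_space_def)

lemma L_z_measurable:
  assumes "\<phi> \<in> X_space V"
  shows "L_z e \<phi> \<in> borel_measurable lebesgue"
proof -
  note X_space_weak_partial_measurable[OF assms, measurable]
  have "(\<lambda>x. L_z e \<phi> x) \<in> borel_measurable lebesgue"
    unfolding L_z_def by measurable
  then show ?thesis .
qed

text \<open>Once the weak partials of \<open>\<phi>\<close> are known to be \<open>r\<close> times
  those of \<open>\<psi>\<close>, each of the four terms scales by the square of the real number
  \<open>r\<close>. The case \<open>r = 1\<close> says that \<open>Q_functional\<close> depends only
  on the almost-everywhere class.\<close>

lemma Q_functional_cmult_AE: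
  assumes \<phi>: "\<phi> \<in> X_space V" and \<psi>: "\<psi> \<in> X_space V"
    and eq: "AE x in lebesgue. \<phi> x = complex_of_real r * \<psi> x"
  shows "Q_functional e V \<Omega> \<omega> \<phi> = r\<^sup>2 * Q_functional e V \<Omega> \<omega> \<psi>"
proof -
  note [measurable] = X_space_measurable[OF \<phi>] X_space_measurable[OF \<psi>]
    X_space_weak_partial_measurable[OF \<phi>] X_space_weak_partial_measurable[OF \<psi>]
    L_z_measurable[OF \<phi>, of e] L_z_measurable[OF \<psi>, of e]
  have [measurable]: "cnj \<in> borel_measurable borel"
    by (intro borel_measurable_continuous_onI continuous_intros)
  \<comment> \<open>There are finitely many indices, so a single null set serves all
    partials.\<close>
  have "AE x in lebesgue. \<forall>i. weak_partial i \<phi> x = of_real r * weak_partial i \<psi> x"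
    unfolding AE_all_countable using weak_partial_cmult_AE[OF \<phi> \<psi> eq] by blast
  with eq have both: "AE x in lebesgue. \<phi> x = of_real r * \<psi> x
      \<and> (\<forall>i. weak_partial i \<phi> x = of_real r * weak_partial i \<psi> x)"
    by (rule AE_conjI)
  have "(LINT x|lebesgue. (norm (weak_gradient \<phi> x))\<^sup>2)
      = (LINT x|lebesgue. r\<^sup>2 * (norm (weak_gradient \<psi> x))\<^sup>2)"
    unfolding norm_weak_gradient_squared
  proof (rule integral_cong_AE)
    show "AE x in lebesgue. (\<Sum>i\<in>UNIV. (cmod (weak_partial i \<phi> x))\<^sup>2)
        = r\<^sup>2 * (\<Sum>i\<in>UNIV. (cmod (weak_partial i \<psi> x))\<^sup>2)"
      using both by eventually_elim (simp add: norm_mult power_mult_distrib sum_distrib_left)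
  qed measurable
  moreover have "(LINT x|lebesgue. V x * (cmod (\<phi> x))\<^sup>2)
      = (LINT x|lebesgue. r\<^sup>2 * (V x * (cmod (\<psi> x))\<^sup>2))"
  proof (rule integral_cong_AE)
    show "(\<lambda>x. V x * (cmod (\<phi> x))\<^sup>2) \<in> borel_measurable lebesgue"
      using \<phi> by (simp add: X_space_def borel_measurable_integrable)
    show "(\<lambda>x. r\<^sup>2 * (V x * (cmod (\<psi> x))\<^sup>2)) \<in> borel_measurable lebesgue"
      using \<psi> by (intro borel_measurable_integrable integrable_mult_right) (simp add: X_space_def)
    show "AE x in lebesgue. V x * (cmod (\<phi> x))\<^sup>2 = r\<^sup>2 * (V x * (cmod (\<psi> x))\<^sup>2)"
      using both by eventually_elim (simp add: norm_mult power_mult_distrib)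
  qed
  moreover have "(LINT x|lebesgue. cnj (\<phi> x) * L_z e \<phi> x)
      = (LINT x|lebesgue. of_real (r\<^sup>2) * (cnj (\<psi> x) * L_z e \<psi> x))"
  proof (rule integral_cong_AE)
    show "AE x in lebesgue. cnj (\<phi> x) * L_z e \<phi> x = of_real (r\<^sup>2) * (cnj (\<psi> x) * L_z e \<psi> x)"
      using both by eventually_elim (simp add: L_z_def power2_eq_square algebra_simps)
  qed measurable
  moreover have "(LINT x|lebesgue. (cmod (\<phi> x))\<^sup>2) = (LINT x|lebesgue. r\<^sup>2 * (cmod (\<psi> x))\<^sup>2)"
  proof (rule integral_cong_AE)
    show "AE x in lebesgue. (cmod (\<phi> x))\<^sup>2 = r\<^sup>2 * (cmod (\<psi> x))\<^sup>2"
      using both by eventually_elim (simp add: norm_mult power_mult_distrib)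
  qed measurable
  ultimately show ?thesis
    unfolding Q_functional_def L_rot_def Lq_norm_2_squared integral_mult_right_zero
    by (simp add: algebra_simps)
qed

subsection \<open>Positivity and the Nehari manifold\<close>

text \<open>The pointwise bound is AM-GM:
  \<open>\<bar>\<Omega> x\<^sub>2 \<phi> \<partial>\<^sub>1\<phi>\<bar> \<le> \<bar>\<partial>\<^sub>1\<phi>\<bar>\<^sup>2 / 2 + \<Omega>\<^sup>2 x\<^sub>2\<^sup>2 \<bar>\<phi>\<bar>\<^sup>2 / 2\<close>, likewise with the indices swapped.\<close>

lemma L_rot_bound:
  fixes e :: "nat \<Rightarrow> 'n::finite"
  assumes \<phi>: "\<phi> \<in> X_space V" and neq: "e 1 \<noteq> e 2"
    and V: "\<And>x. 1 / 2 * \<Omega>\<^sup>2 * ((x $ e 1)\<^sup>2 + (x $ e 2)\<^sup>2) \<le> V x"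
  shows "- L_rot e \<Omega> \<phi> \<le>
    1 / 2 * (Lq_norm 2 (weak_gradient \<phi>))\<^sup>2 + (LINT x|lebesgue. V x * (cmod (\<phi> x))\<^sup>2)"
proof -
  let ?G = "\<lambda>x. 1 / 2 * (norm (weak_gradient \<phi> x))\<^sup>2 + V x * (cmod (\<phi> x))\<^sup>2"
  let ?R = "\<lambda>x. cnj (\<phi> x) * L_z e \<phi> x"
  have pointwise: "\<Omega> * Re (?R x) \<le> ?G x" for x
  proof -
    define a where "a = cmod (weak_partial (e 1) \<phi> x)"
    define b where "b = cmod (weak_partial (e 2) \<phi> x)"
    define f where "f = cmod (\<phi> x)"
    define s where "s = \<bar>\<Omega>\<bar> * \<bar>x $ e 2\<bar> * f"
    define t where "t = \<bar>\<Omega>\<bar> * \<bar>x $ e 1\<bar> * f"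
    have Lz: "cmod (L_z e \<phi> x) \<le> \<bar>x $ e 2\<bar> * a + \<bar>x $ e 1\<bar> * b"
      using norm_triangle_ineq4[of "of_real (x $ e 2) * weak_partial (e 1) \<phi> x"
          "of_real (x $ e 1) * weak_partial (e 2) \<phi> x"]
      by (simp add: L_z_def a_def b_def norm_mult)
    have "\<Omega> * Re (?R x) \<le> \<bar>\<Omega>\<bar> * cmod (?R x)"
    proof -
      have "\<Omega> * Re (?R x) \<le> \<bar>\<Omega>\<bar> * \<bar>Re (?R x)\<bar>"
        by (simp only: abs_mult[symmetric] abs_ge_self)
      also have "\<dots> \<le> \<bar>\<Omega>\<bar> * cmod (?R x)"
        by (intro mult_left_mono abs_Re_le_cmod abs_ge_zero)
      finally show ?thesis .
    qed
    also have "\<dots> \<le> \<bar>\<Omega>\<bar> * (f * (\<bar>x $ e 2\<bar> * a + \<bar>x $ e 1\<bar> * b))"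
      using Lz by (simp add: norm_mult f_def mult_left_mono)
    also have "\<dots> = s * a + t * b"
      by (simp add: s_def t_def algebra_simps)
    also have "\<dots> \<le> 1 / 2 * (a\<^sup>2 + b\<^sup>2) + 1 / 2 * (s\<^sup>2 + t\<^sup>2)"
      using sum_squares_bound[of s a] sum_squares_bound[of t b] by (simp add: field_simps)
    finally have bound: "\<Omega> * Re (?R x) \<le> 1 / 2 * (a\<^sup>2 + b\<^sup>2) + 1 / 2 * (s\<^sup>2 + t\<^sup>2)" .
    have grad: "a\<^sup>2 + b\<^sup>2 \<le> (norm (weak_gradient \<phi> x))\<^sup>2"
    proof -
      have "a\<^sup>2 + b\<^sup>2 = (\<Sum>i\<in>{e 1, e 2}. (cmod (weak_partial i \<phi> x))\<^sup>2)"
        using neq by (simp add: a_def b_def)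
      also have "\<dots> \<le> (\<Sum>i\<in>UNIV. (cmod (weak_partial i \<phi> x))\<^sup>2)"
        by (intro sum_mono2) auto
      finally show ?thesis by (simp add: norm_weak_gradient_squared)
    qed
    have "1 / 2 * (s\<^sup>2 + t\<^sup>2) = 1 / 2 * \<Omega>\<^sup>2 * ((x $ e 1)\<^sup>2 + (x $ e 2)\<^sup>2) * f\<^sup>2"
      by (simp add: s_def t_def power_mult_distrib algebra_simps)
    also have "\<dots> \<le> V x * f\<^sup>2"
      using V by (rule mult_right_mono) simp
    finally have pot: "1 / 2 * (s\<^sup>2 + t\<^sup>2) \<le> V x * f\<^sup>2" .
    have "1 / 2 * (a\<^sup>2 + b\<^sup>2) + 1 / 2 * (s\<^sup>2 + t\<^sup>2) \<le> ?G x"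
      unfolding f_def[symmetric] by (intro add_mono mult_left_mono grad pot) simp
    with bound show ?thesis by (rule order_trans)
  qed
  have G: "integrable lebesgue ?G"
    using integrable_norm_weak_gradient_squared[OF \<phi>] \<phi>
    by (intro Bochner_Integration.integrable_add integrable_mult_right) (auto simp: X_space_def)
  have Gint: "(LINT x|lebesgue. ?G x)
      = 1 / 2 * (Lq_norm 2 (weak_gradient \<phi>))\<^sup>2 + (LINT x|lebesgue. V x * (cmod (\<phi> x))\<^sup>2)"
    using integrable_norm_weak_gradient_squared[OF \<phi>] \<phi>
    by (subst Bochner_Integration.integral_add) (auto simp: X_space_def Lq_norm_2_squared)
  show ?thesis
  proof (cases "integrable lebesgue ?R")
    case True
    have "\<Omega> * Re (LINT x|lebesgue. ?R x) = (LINT x|lebesgue. \<Omega> * Re (?R x))"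
      using True by (simp only: integral_Re[symmetric] integral_mult_right_zero)
    also have "\<dots> \<le> (LINT x|lebesgue. ?G x)"
      using G pointwise True by (intro integral_mono integrable_mult_right integrable_Re)
    finally show ?thesis unfolding Gint L_rot_def by simp
  next
    \<comment> \<open>The rotation integral then has the default value 0, and nonnegativity of
      \<open>V\<close>, implied by its lower bound, suffices.\<close>
    case False
    have "0 \<le> V x" for x
      by (rule order_trans[OF _ V]) simp
    then have "0 \<le> (LINT x|lebesgue. V x * (cmod (\<phi> x))\<^sup>2)"
      by simp
    then show ?thesis using False by (simp add: L_rot_def not_integrable_integral_eq)
  qed
qed

lemma Q_functional_shift:
  "Q_functional e V \<Omega> \<omega> \<phi> = Q_functional e V \<Omega> 0 \<phi> + \<omega> * (Lq_norm 2 \<phi>)\<^sup>2"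
  by (simp add: Q_functional_def)

text \<open>Without rotation every term is nonnegative. In the harmonic case,
  \<open>\<bar>\<Omega>\<bar>\<close> lies below the first two trap frequencies, so the trap
  dominates the potential required by \<open>L_rot_bound\<close>.\<close>

lemma energy_nonneg:
  fixes e :: "nat \<Rightarrow> 'n::finite"
  assumes coords: "bij_betw e {1..CARD('n)} UNIV"
    and setting:
      "(\<Omega> = 0 \<and> (\<forall>x. V x \<ge> 0))
       \<or> (CARD('n) \<ge> 2 \<and>
          (\<exists>\<gamma> :: nat \<Rightarrow> real.
             (\<forall>x. V x = 1 / 2 * (\<Sum>j=1..CARD('n). (\<gamma> j)\<^sup>2 * (x $ e j)\<^sup>2)) \<and>
             \<bar>\<Omega>\<bar> < min (\<gamma> 1) (\<gamma> 2)))"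
    and \<phi>: "\<phi> \<in> X_space V"
  shows "0 \<le> Q_functional e V \<Omega> 0 \<phi>"
  using setting
proof (elim disjE conjE exE)
  assume "\<Omega> = 0" "\<forall>x. V x \<ge> 0"
  then show ?thesis by (simp add: Q_functional_def L_rot_def)
next
  fix \<gamma> :: "nat \<Rightarrow> real"
  assume card: "CARD('n) \<ge> 2"
    and V: "\<forall>x. V x = 1 / 2 * (\<Sum>j=1..CARD('n). (\<gamma> j)\<^sup>2 * (x $ e j)\<^sup>2)"
    and \<Omega>: "\<bar>\<Omega>\<bar> < min (\<gamma> 1) (\<gamma> 2)"
  have "inj_on e {1..CARD('n)}"
    using coords by (simp add: bij_betw_def)
  then have neq: "e 1 \<noteq> e 2"
    using card by (simp add: inj_on_eq_iff)
  have "1 / 2 * \<Omega>\<^sup>2 * ((x $ e 1)\<^sup>2 + (x $ e 2)\<^sup>2) \<le> V x" for x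
  proof -
    have sq: "\<Omega>\<^sup>2 \<le> (\<gamma> 1)\<^sup>2" "\<Omega>\<^sup>2 \<le> (\<gamma> 2)\<^sup>2"
      using \<Omega> by (auto simp: abs_le_square_iff[symmetric])
    have "\<Omega>\<^sup>2 * (x $ e 1)\<^sup>2 + \<Omega>\<^sup>2 * (x $ e 2)\<^sup>2 \<le> (\<Sum>j\<in>{1, 2}. (\<gamma> j)\<^sup>2 * (x $ e j)\<^sup>2)"
      using sq by (simp add: add_mono mult_right_mono)
    also have "\<dots> \<le> (\<Sum>j=1..CARD('n). (\<gamma> j)\<^sup>2 * (x $ e j)\<^sup>2)"
      using card by (intro sum_mono2) auto
    also have "\<dots> = 2 * V x"
      by (simp add: V[rule_format, of x])
    finally show ?thesis by (simp add: algebra_simps)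
  qed
  from L_rot_bound[OF \<phi> neq this] show ?thesis
    by (simp add: Q_functional_def)
qed

text \<open>After normalization in the L2 norm the energy is at least \<open>lambda0\<close>, so
  adding \<open>\<omega>\<close> gives a positive value; homogeneity carries this back to
  \<open>\<phi>\<close>.\<close>

lemma Q_functional_pos:
  assumes nonneg: "\<And>u. u \<in> X_space V \<Longrightarrow> 0 \<le> Q_functional e V \<Omega> 0 u"
    and omega: "\<omega> > - lambda0 e V \<Omega>"
    and \<phi>: "\<phi> \<in> X_space V" and nz: "\<not> (AE x in lebesgue. \<phi> x = 0)"
  shows "0 < Q_functional e V \<Omega> \<omega> \<phi>"
proof -
  define N where "N = Lq_norm 2 \<phi>"
  have "N \<noteq> 0"
    using L2_space_norm_eq_0[of \<phi>] \<phi> nz by (auto simp: N_def X_space_def H1_space_def)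
  then have N: "N > 0"
    using Lq_norm_nonneg[of 2 \<phi>] by (simp add: N_def)
  define u where "u = (\<lambda>x. complex_of_real (1 / N) * \<phi> x)"
  have u: "u \<in> X_space V"
    unfolding u_def using \<phi> by (rule X_space_cmult)
  have "Lq_norm 2 u = 1 / N * Lq_norm 2 \<phi>"
    using N X_space_measurable[OF u] X_space_measurable[OF \<phi>]
    by (intro Lq_norm_cmult_AE) (auto simp: u_def norm_mult norm_divide)
  then have u1: "Lq_norm 2 u = 1"
    using N by (simp add: N_def)
  have "lambda0 e V \<Omega> \<le> Q_functional e V \<Omega> 0 u"
    unfolding lambda0_def
  proof (rule cInf_lower)
    \<comment> \<open>\<open>cInf_lower\<close> asks for a lower bound of the energies;
      nonnegativity supplies 0.\<close>
    show "bdd_below {1 / 2 * (Lq_norm 2 (weak_gradient u))\<^sup>2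
          + (LINT x|lebesgue. V x * (cmod (u x))\<^sup>2) + L_rot e \<Omega> u | u.
          u \<in> X_space V \<and> Lq_norm 2 u = 1}"
      using nonneg by (intro bdd_belowI[of _ 0]) (auto simp: Q_functional_def)
  qed (use u u1 in \<open>auto simp: Q_functional_def\<close>)
  then have "0 < Q_functional e V \<Omega> \<omega> u"
    using omega u1 by (subst Q_functional_shift) simp
  moreover have "Q_functional e V \<Omega> \<omega> \<phi> = N\<^sup>2 * Q_functional e V \<Omega> \<omega> u"
    using N by (intro Q_functional_cmult_AE[OF \<phi> u] AE_I2) (simp add: u_def)
  ultimately show ?thesis using N by simp
qed

section \<open>Maps and bijections on almost-everywhere classes\<close>

lemma equiv_ae_eq: "equiv UNIV ae_eq"
  by (rule equivI) (auto simp: ae_eq_def refl_on_def sym_def trans_def)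

text \<open>\<open>class_map\<close> collects the classes of the images of all representatives; when
  these images agree almost everywhere, the union collapses to one class.\<close>

lemma class_map_ae_class:
  assumes "\<And>g. (f, g) \<in> ae_eq \<Longrightarrow> (F f, F g) \<in> ae_eq"
  shows "class_map F (ae_eq `` {f}) = ae_eq `` {F f}"
proof -
  have "ae_eq `` {F g} = ae_eq `` {F f}" if "g \<in> ae_eq `` {f}" for g
    using equiv_class_eq[OF equiv_ae_eq assms, of g] that by simp
  moreover have "f \<in> ae_eq `` {f}"
    by (simp add: ae_eq_def)
  ultimately show ?thesis unfolding class_map_def by blast
qed

text \<open>Reduces bijectivity on classes to statements about representatives: injectivity is
  required up to \<open>ae_eq\<close>, while preimages are exact.\<close>

lemma bij_betw_class_map:
  assumes cong: "\<And>f g. f \<in> A \<Longrightarrow> (f, g) \<in> ae_eq \<Longrightarrow> (F f, F g) \<in> ae_eq"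
    and into: "\<And>f. f \<in> A \<Longrightarrow> F f \<in> B"
    and inj: "\<And>f g. f \<in> A \<Longrightarrow> g \<in> A \<Longrightarrow> (F f, F g) \<in> ae_eq \<Longrightarrow> (f, g) \<in> ae_eq"
    and onto: "\<And>u. u \<in> B \<Longrightarrow> \<exists>f\<in>A. F f = u"
  shows "bij_betw (class_map F) (A // ae_eq) (B // ae_eq)"
proof -
  have cls: "class_map F (ae_eq `` {f}) = ae_eq `` {F f}" if "f \<in> A" for f
    using cong[OF that] by (rule class_map_ae_class)
  show ?thesis
    unfolding bij_betw_def
  proof
    show "inj_on (class_map F) (A // ae_eq)"
    proof (rule inj_onI, elim quotientE)
      fix C D f g
      assume "class_map F C = class_map F D" and f: "f \<in> A" "C = ae_eq `` {f}"
        and g: "g \<in> A" "D = ae_eq `` {g}"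
      then have "ae_eq `` {F f} = ae_eq `` {F g}"
        by (simp add: cls)
      then have "(F f, F g) \<in> ae_eq"
        using eq_equiv_class[OF _ equiv_ae_eq] by blast
      then show "C = D"
        using equiv_class_eq[OF equiv_ae_eq inj] f g by simp
    qed
    have "class_map F ` (A // ae_eq) = (\<lambda>f. ae_eq `` {F f}) ` A"
      by (auto simp: quotient_def image_UN cls)
    also have "\<dots> = (\<lambda>u. ae_eq `` {u}) ` B"
      using into onto by force
    also have "\<dots> = B // ae_eq"
      by (auto simp: quotient_def)
    finally show "class_map F ` (A // ae_eq) = B // ae_eq" .
  qed
qed

lemma powr_le_powr_iff:
  fixes x y r :: real
  assumes "0 < r" "0 < x" "0 < y"
  shows "x powr r \<le> y powr r \<longleftrightarrow> x \<le> y"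
  using assms powr_less_mono2[of r y x] powr_mono2[of r x y] by linarith

lemma action_functional_eq:
  "action_functional e V p \<beta> \<Omega> \<omega> \<phi> =
    Q_functional e V \<Omega> \<omega> \<phi> + 2 * \<beta> / (p + 1) * Lq_norm (p + 1) \<phi> powr (p + 1)"
  by (simp add: action_functional_def Q_functional_def)

lemma nehari_functional_eq:
  "nehari_functional e V p \<beta> \<Omega> \<omega> \<phi> =
    Q_functional e V \<Omega> \<omega> \<phi> + \<beta> * Lq_norm (p + 1) \<phi> powr (p + 1)"
  by (simp add: nehari_functional_def Q_functional_def)

lemma normalize_Lq_eq_cmult:
  "normalize_Lq q \<phi> = (\<lambda>x. complex_of_real (1 / Lq_norm q \<phi>) * \<phi> x)"
  by (auto simp: normalize_Lq_def)

lemma normalize_Lq_cong_AE: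
  assumes "f \<in> borel_measurable lebesgue" "(f, g) \<in> ae_eq" "q \<noteq> 0"
  shows "(normalize_Lq q f, normalize_Lq q g) \<in> ae_eq"
proof -
  have eq: "AE x in lebesgue. f x = g x"
    using assms(2) by (simp add: ae_eq_def)
  \<comment> \<open>Completeness of \<open>lebesgue\<close> makes \<open>g\<close> measurable, as an
    almost-everywhere modification of \<open>f\<close>.\<close>
  then have g: "g \<in> borel_measurable lebesgue"
    using assms(1) borel_measurable_AE by blast
  have "Lq_norm q f = 1 * Lq_norm q g"
    by (rule Lq_norm_cmult_AE[OF assms(1) g]) (use eq assms(3) in auto)
  with eq show ?thesis by (simp add: ae_eq_def normalize_Lq_def)
qed

section \<open>Normalization and action on the Nehari manifold, given positivity of the quadratic
  functional\<close>

context
  fixes e :: "nat \<Rightarrow> 'n::finite" and V :: "real ^ 'n \<Rightarrow> real" and p \<Omega> \<omega> \<beta> :: real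
  assumes p_gt: "1 < p" and beta: "\<beta> < 0"
    and Q_pos: "\<And>\<phi>. \<phi> \<in> X_space V \<Longrightarrow> \<not> (AE x in lebesgue. \<phi> x = 0) \<Longrightarrow>
      0 < Q_functional e V \<Omega> \<omega> \<phi>"
begin

text \<open>Positivity of \<open>Q\<close> rules out \<open>Lq_norm (p + 1) \<phi> = 0\<close>, so \<open>\<bar>\<phi>\<bar>\<^sup>p\<^sup>+\<^sup>1\<close> is integrable
  on the Nehari manifold and no Sobolev embedding is needed.\<close>

lemma nehari_manifold_Lq_norm:
  assumes "\<phi> \<in> nehari_manifold e V p \<beta> \<Omega> \<omega>"
  shows "0 < Lq_norm (p + 1) \<phi>"
    and "Q_functional e V \<Omega> \<omega> \<phi> = - \<beta> * Lq_norm (p + 1) \<phi> powr (p + 1)"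
proof -
  show eq: "Q_functional e V \<Omega> \<omega> \<phi> = - \<beta> * Lq_norm (p + 1) \<phi> powr (p + 1)"
    using assms by (simp add: nehari_manifold_def nehari_functional_eq)
  have "0 < Q_functional e V \<Omega> \<omega> \<phi>"
    using assms Q_pos by (simp add: nehari_manifold_def)
  with eq have "Lq_norm (p + 1) \<phi> \<noteq> 0" by auto
  then show "0 < Lq_norm (p + 1) \<phi>"
    using Lq_norm_nonneg[of "p + 1" \<phi>] by simp
qed

lemma normalize_nehari_manifold:
  assumes "\<phi> \<in> nehari_manifold e V p \<beta> \<Omega> \<omega>"
  shows "normalize_Lq (p + 1) \<phi> \<in> unit_sphere V (p + 1)"
    and "Q_functional e V \<Omega> \<omega> (normalize_Lq (p + 1) \<phi>) = - \<beta> * Lq_norm (p + 1) \<phi> powr (p - 1)"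
proof -
  let ?u = "normalize_Lq (p + 1) \<phi>"
  define L where "L = Lq_norm (p + 1) \<phi>"
  note L = nehari_manifold_Lq_norm[OF assms, folded L_def]
  have \<phi>: "\<phi> \<in> X_space V"
    using assms by (simp add: nehari_manifold_def)
  have u_def: "?u = (\<lambda>x. complex_of_real (1 / L) * \<phi> x)"
    by (simp add: normalize_Lq_eq_cmult L_def)
  have u: "?u \<in> X_space V"
    unfolding u_def using \<phi> by (rule X_space_cmult)
  have "Lq_norm (p + 1) ?u = 1 / L * Lq_norm (p + 1) \<phi>"
    using L p_gt X_space_measurable[OF u] X_space_measurable[OF \<phi>]
    by (intro Lq_norm_cmult_AE) (auto simp: u_def norm_mult norm_divide)
  with u L show "?u \<in> unit_sphere V (p + 1)"
    by (simp add: unit_sphere_def L_def)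
  have "Q_functional e V \<Omega> \<omega> ?u = (1 / L)\<^sup>2 * Q_functional e V \<Omega> \<omega> \<phi>"
    by (rule Q_functional_cmult_AE[OF u \<phi>]) (simp add: u_def)
  also have "\<dots> = - \<beta> * (L powr (p + 1) / L powr 2)"
    using L by (simp add: power_divide powr_numeral)
  also have "L powr (p + 1) / L powr 2 = L powr (p - 1)"
    by (simp add: powr_diff[symmetric])
  finally show "Q_functional e V \<Omega> \<omega> ?u = - \<beta> * L powr (p - 1)" .
qed

text \<open>Inserting the value of \<open>Q_functional\<close> on the manifold leaves the
  coefficient \<open>- \<beta> + 2 * \<beta> / (p + 1)\<close>.\<close>

lemma action_on_nehari_manifold:
  assumes "\<phi> \<in> nehari_manifold e V p \<beta> \<Omega> \<omega>"
  shows "action_functional e V p \<beta> \<Omega> \<omega> \<phi> =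
    - \<beta> * ((p - 1) / (p + 1)) * Lq_norm (p + 1) \<phi> powr (p + 1)"
  unfolding action_functional_eq nehari_manifold_Lq_norm(2)[OF assms]
  using p_gt by (simp add: field_simps)

lemma nehari_manifold_normalize_surj:
  assumes u: "u \<in> unit_sphere V (p + 1)"
  shows "\<exists>\<phi>\<in>nehari_manifold e V p \<beta> \<Omega> \<omega>. normalize_Lq (p + 1) \<phi> = u"
proof -
  have uX: "u \<in> X_space V" and u1: "Lq_norm (p + 1) u = 1"
    using u by (auto simp: unit_sphere_def)
  have nz: "\<not> (AE x in lebesgue. u x = 0)"
  proof
    assume "AE x in lebesgue. u x = 0"
    \<comment> \<open>Scaling with factor 0 forces the norm to be 0, against its value 1.\<close>
    then have "Lq_norm (p + 1) u = 0 * Lq_norm (p + 1) u"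
      using p_gt X_space_measurable[OF uX] by (intro Lq_norm_cmult_AE) auto
    with u1 show False by simp
  qed
  define q where "q = Q_functional e V \<Omega> \<omega> u"
  have q: "q > 0"
    unfolding q_def using uX nz by (rule Q_pos)
  \<comment> \<open>This \<open>t\<close> is the positive root of
    \<open>t\<^sup>2 * q + \<beta> * t powr (p + 1) = 0\<close>, the Nehari equation for the
    multiple \<open>t * u\<close>.\<close>
  define t where "t = (q / - \<beta>) powr (1 / (p - 1))"
  have t: "t > 0"
    using q beta by (simp add: t_def divide_pos_neg)
  have tp: "t powr (p - 1) = q / - \<beta>"
    using q beta p_gt by (simp add: t_def powr_powr divide_pos_neg less_imp_le)
  define \<phi> where "\<phi> = (\<lambda>x. complex_of_real t * u x)"
  have \<phi>X: "\<phi> \<in> X_space V"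
    unfolding \<phi>_def using uX by (rule X_space_cmult)
  have "Lq_norm (p + 1) \<phi> = t * Lq_norm (p + 1) u"
    using t p_gt X_space_measurable[OF uX] X_space_measurable[OF \<phi>X]
    by (intro Lq_norm_cmult_AE) (auto simp: \<phi>_def norm_mult)
  then have \<phi>t: "Lq_norm (p + 1) \<phi> = t"
    using u1 by simp
  have Q\<phi>: "Q_functional e V \<Omega> \<omega> \<phi> = t\<^sup>2 * q"
    unfolding q_def by (rule Q_functional_cmult_AE[OF \<phi>X uX]) (simp add: \<phi>_def)
  have "t powr (p + 1) = t powr (p - 1) * t powr 2"
    by (simp add: powr_add[symmetric] add.commute)
  then have "\<beta> * t powr (p + 1) = - (t\<^sup>2 * q)"
    using tp t beta by (simp add: powr_numeral)
  then have "nehari_functional e V p \<beta> \<Omega> \<omega> \<phi> = 0"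
    by (simp add: nehari_functional_eq \<phi>t Q\<phi>)
  moreover have "\<not> (AE x in lebesgue. \<phi> x = 0)"
    using nz t by (simp add: \<phi>_def)
  ultimately have "\<phi> \<in> nehari_manifold e V p \<beta> \<Omega> \<omega>"
    using \<phi>X by (simp add: nehari_manifold_def)
  moreover have "normalize_Lq (p + 1) \<phi> = u"
    using t unfolding normalize_Lq_eq_cmult \<phi>t by (simp add: \<phi>_def)
  ultimately show ?thesis by blast
qed

lemma nehari_manifold_normalize_inj:
  assumes \<phi>: "\<phi> \<in> nehari_manifold e V p \<beta> \<Omega> \<omega>" and \<psi>: "\<psi> \<in> nehari_manifold e V p \<beta> \<Omega> \<omega>"
    and eq: "(normalize_Lq (p + 1) \<phi>, normalize_Lq (p + 1) \<psi>) \<in> ae_eq"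
  shows "(\<phi>, \<psi>) \<in> ae_eq"
proof -
  let ?F = "normalize_Lq (p + 1)"
  have X: "?F \<phi> \<in> X_space V" "?F \<psi> \<in> X_space V"
    using normalize_nehari_manifold(1) \<phi> \<psi> by (auto simp: unit_sphere_def)
  have ae: "AE x in lebesgue. ?F \<phi> x = ?F \<psi> x"
    using eq by (simp add: ae_eq_def)
  \<comment> \<open>The instance \<open>r = 1\<close> compares representatives of one class; equal
    values then force equal norms, so the normalization can be undone.\<close>
  then have "Q_functional e V \<Omega> \<omega> (?F \<phi>) = 1\<^sup>2 * Q_functional e V \<Omega> \<omega> (?F \<psi>)"
    using X by (intro Q_functional_cmult_AE) auto
  then have "Lq_norm (p + 1) \<phi> powr (p - 1) = Lq_norm (p + 1) \<psi> powr (p - 1)"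
    using beta \<phi> \<psi> by (simp add: normalize_nehari_manifold(2))
  then have "Lq_norm (p + 1) \<phi> = Lq_norm (p + 1) \<psi>"
    using p_gt nehari_manifold_Lq_norm(1)[OF \<phi>] nehari_manifold_Lq_norm(1)[OF \<psi>]
    by (intro antisym) (simp_all add: powr_le_powr_iff[of "p - 1", symmetric])
  with ae nehari_manifold_Lq_norm(1)[OF \<psi>] show ?thesis
    by (simp add: ae_eq_def normalize_Lq_def)
qed

text \<open>Up to positive coefficients the two sides compare the norms raised to
  \<open>p + 1\<close> and to \<open>p - 1\<close>. Both exponents are positive, so each comparison
  is that of the norms themselves.\<close>

lemma action_le_iff_Q_le:
  assumes \<phi>: "\<phi> \<in> nehari_manifold e V p \<beta> \<Omega> \<omega>" and \<psi>: "\<psi> \<in> nehari_manifold e V p \<beta> \<Omega> \<omega>"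
  shows "action_functional e V p \<beta> \<Omega> \<omega> \<phi> \<le> action_functional e V p \<beta> \<Omega> \<omega> \<psi> \<longleftrightarrow>
    Q_functional e V \<Omega> \<omega> (normalize_Lq (p + 1) \<phi>) \<le> Q_functional e V \<Omega> \<omega> (normalize_Lq (p + 1) \<psi>)"
proof -
  let ?L = "Lq_norm (p + 1)"
  note pos = nehari_manifold_Lq_norm(1)[OF \<phi>] nehari_manifold_Lq_norm(1)[OF \<psi>]
  have "0 < - \<beta> * ((p - 1) / (p + 1))"
    using p_gt beta by (intro mult_pos_pos divide_pos_pos) auto
  then have "action_functional e V p \<beta> \<Omega> \<omega> \<phi> \<le> action_functional e V p \<beta> \<Omega> \<omega> \<psi> \<longleftrightarrow>
      ?L \<phi> powr (p + 1) \<le> ?L \<psi> powr (p + 1)"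
    unfolding action_on_nehari_manifold[OF \<phi>] action_on_nehari_manifold[OF \<psi>]
    by (rule mult_le_cancel_left_pos)
  also have "\<dots> \<longleftrightarrow> ?L \<phi> powr (p - 1) \<le> ?L \<psi> powr (p - 1)"
    using pos p_gt by (simp add: powr_le_powr_iff)
  finally show ?thesis
    using beta by (simp add: normalize_nehari_manifold(2)[OF \<phi>] normalize_nehari_manifold(2)[OF \<psi>])
qed

end

theorem theorem2p3:
  fixes e :: "nat \<Rightarrow> 'n::finite" and V :: "real ^ 'n \<Rightarrow> real" and p \<Omega> \<omega> \<beta> :: real
  assumes coords: "bij_betw e {1..CARD('n)} UNIV"
    and p_gt: "1 < p"
    and p_less: "CARD('n) \<ge> 3 \<longrightarrow> p < (real CARD('n) + 2) / (real CARD('n) - 2)"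
    and setting:
      "(\<Omega> = 0 \<and> (\<forall>x. V x = 0))
       \<or> (\<Omega> = 0 \<and> (\<forall>x. V x \<ge> 0) \<and> filterlim V at_top at_infinity)
       \<or> (CARD('n) \<ge> 2 \<and>
          (\<exists>\<gamma> :: nat \<Rightarrow> real.
             (\<forall>j\<in>{1..CARD('n)}. \<gamma> j > 0) \<and>
             (\<forall>x. V x = 1 / 2 * (\<Sum>j=1..CARD('n). (\<gamma> j)\<^sup>2 * (x $ e j)\<^sup>2)) \<and>
             \<bar>\<Omega>\<bar> < min (\<gamma> 1) (\<gamma> 2)))"
    and beta: "\<beta> < 0"
    and omega: "\<omega> > - lambda0 e V \<Omega>"
  shows "bij_betw (class_map (normalize_Lq (p + 1)))
           (nehari_manifold e V p \<beta> \<Omega> \<omega> // ae_eq) (unit_sphere V (p + 1) // ae_eq)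
    \<and> (\<forall>\<phi>\<in>nehari_manifold e V p \<beta> \<Omega> \<omega>.
         (\<forall>\<psi>\<in>nehari_manifold e V p \<beta> \<Omega> \<omega>.
            action_functional e V p \<beta> \<Omega> \<omega> \<phi> \<le> action_functional e V p \<beta> \<Omega> \<omega> \<psi>)
         \<longleftrightarrow> normalize_Lq (p + 1) \<phi> \<in> unit_sphere V (p + 1) \<and>
             (\<forall>u\<in>unit_sphere V (p + 1).
                Q_functional e V \<Omega> \<omega> (normalize_Lq (p + 1) \<phi>) \<le> Q_functional e V \<Omega> \<omega> u))"
proof -
  \<comment> \<open>The zero potential and the confining potential both fall under the first
    alternative of \<open>energy_nonneg\<close>.\<close>
  have "0 \<le> Q_functional e V \<Omega> 0 u" if "u \<in> X_space V" for u
    by (rule energy_nonneg[OF coords _ that]) (use setting in auto)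
  then have Q_pos: "0 < Q_functional e V \<Omega> \<omega> \<phi>"
    if "\<phi> \<in> X_space V" "\<not> (AE x in lebesgue. \<phi> x = 0)" for \<phi>
    using omega that by (rule Q_functional_pos)
  note nehari = p_gt beta Q_pos
  let ?M = "nehari_manifold e V p \<beta> \<Omega> \<omega>" and ?S = "unit_sphere V (p + 1)"
    and ?F = "normalize_Lq (p + 1)"
  have into: "?F \<phi> \<in> ?S" if "\<phi> \<in> ?M" for \<phi>
    using nehari that by (rule normalize_nehari_manifold(1))
  have onto: "\<exists>\<phi>\<in>?M. ?F \<phi> = u" if "u \<in> ?S" for u
    using nehari that by (rule nehari_manifold_normalize_surj)
  have "bij_betw (class_map ?F) (?M // ae_eq) (?S // ae_eq)"
  proof (rule bij_betw_class_map[OF _ into _ onto])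
    show "(?F f, ?F g) \<in> ae_eq" if "f \<in> ?M" "(f, g) \<in> ae_eq" for f g
      using that p_gt X_space_measurable
      by (intro normalize_Lq_cong_AE) (auto simp: nehari_manifold_def)
    show "(f, g) \<in> ae_eq" if "f \<in> ?M" "g \<in> ?M" "(?F f, ?F g) \<in> ae_eq" for f g
      using nehari that by (rule nehari_manifold_normalize_inj)
  qed
  moreover have "(\<forall>\<psi>\<in>?M. action_functional e V p \<beta> \<Omega> \<omega> \<phi> \<le> action_functional e V p \<beta> \<Omega> \<omega> \<psi>)
      \<longleftrightarrow> ?F \<phi> \<in> ?S \<and> (\<forall>u\<in>?S. Q_functional e V \<Omega> \<omega> (?F \<phi>) \<le> Q_functional e V \<Omega> \<omega> u)"
    if \<phi>: "\<phi> \<in> ?M" for \<phi>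
  proof -
    have le_iff: "action_functional e V p \<beta> \<Omega> \<omega> \<phi> \<le> action_functional e V p \<beta> \<Omega> \<omega> \<psi> \<longleftrightarrow>
        Q_functional e V \<Omega> \<omega> (?F \<phi>) \<le> Q_functional e V \<Omega> \<omega> (?F \<psi>)" if "\<psi> \<in> ?M" for \<psi>
      using nehari \<phi> that by (rule action_le_iff_Q_le)
    \<comment> \<open>Every \<open>u\<close> in \<open>?S\<close> is the normalization of a member
      of \<open>?M\<close>, so ranging over \<open>?S\<close> amounts to ranging over the
      normalizations of \<open>?M\<close>, where \<open>le_iff\<close> applies.\<close>
    show ?thesis
      using into[OF \<phi>] into onto le_iff by metis
  qed
  ultimately show ?thesis by blast
qed

end
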